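(* For $i,j\in\{1,2\}$ let $A_i\ge\alpha_i>0$, $\tau_i\ge 0$, $\sigma_{ij}\ge 0$, $L_{ij}\ge 0$ be constants. Consider the system $$\dot{x}_i(t)=-a_i(t)x_i(h_i(t))+\sum_{j=1}^2 F_{ij}\bigl(t,x_j(g_{ij}(t))\bigr),\qquad t\ge t_0,\ i=1,2,$$ with $t_0\ge 0$ arbitrary and initial conditions $x_i(t)=\varphi_i(t)$, $t\le t_0$, under the assumptions: (i) $a_i$ are Lebesgue measurable essentially bounded functions on $[0,\infty)$ with $\alpha_i\le a_i(t)\le A_i$; (ii) $F_{ij}(t,\cdot)$ are continuous, $F_{ij}(\cdot,u)$ are measurable and locally essentially bounded, and $|F_{ij}(t,u)|\le L_{ij}|u|$ for $t\ge 0$ and $u\in\mathbb{R}$; (iii) $h_i,g_{ij}$ are measurable functions with $0\le t-h_i(t)\le\tau_i$ and $0\le t-g_{ij}(t)\le\sigma_{ij}$; (iv) $\varphi_i$ are continuous on $[t_0-\sigma,t_0]$, where $\sigma=\max\{\tau_k,\sigma_{ij}: i,j,k=1,2\}$; (v) each such initial value problem has a unique solution on $[t_0,\infty)$. Suppose that $A_1(A_1+L_{11})\tau_1+L_{11}<\alpha_1$ and $$\bigl(\alpha_1-A_1(A_1+L_{11})\tau_1-L_{11}\bigr)\bigl(\alpha_2-A_2(A_2+L_{22})\tau_2-L_{22}\bigr)>L_{12}L_{21}(1+A_1\tau_1)(1+A_2\tau_2).$$ Then the system is globally exponentially stable.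
   Context: A solution $X=(x_1,x_2)^T$ of the initial value problem is a function, locally absolutely continuous on $[t_0,\infty)$, satisfying the differential system almost everywhere for $t>t_0$ and the initial conditions for $t\le t_0$ (that is, on $[t_0-\sigma,t_0]$). Global exponential stability: there exist $M>0$, $\lambda>0$, not depending on $t_0$, such that for every $t_0\ge 0$ and every initial function $\varphi=(\varphi_1,\varphi_2)^T$ the solution $X$ satisfies $$\|X(t)\|\le Me^{-\lambda(t-t_0)}\Bigl(\|X(t_0)\|+\sup_{t_0-\sigma\le s<t_0}\|\varphi(s)\|\Bigr),\qquad t\ge t_0,$$ where $\|\cdot\|$ is a fixed norm on $\mathbb{R}^2$ (the supremum over an empty set is read as $0$). *)

theory Defs
  imports "HOL-Analysis.Analysis"
begin

definition is_norm :: "('a::real_vector \<Rightarrow> real) \<Rightarrow> bool" where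
  "is_norm N \<longleftrightarrow>
     (\<forall>x. 0 \<le> N x) \<and> (\<forall>x. N x = 0 \<longleftrightarrow> x = 0) \<and>
     (\<forall>c x. N (c *\<^sub>R x) = \<bar>c\<bar> * N x) \<and> (\<forall>x y. N (x + y) \<le> N x + N y)"

text \<open>Absolute continuity of a function on an interval. (The constant
  \<^const>\<open>absolutely_continuous\<close> is about measures.) The intervals need
  only be non-overlapping: they may share endpoints.\<close>

definition abs_cont_on :: "real set \<Rightarrow> (real \<Rightarrow> 'a::real_normed_vector) \<Rightarrow> bool" where
  "abs_cont_on S f \<longleftrightarrow>
     (\<forall>\<epsilon>>0. \<exists>\<delta>>0. \<forall>n (u::nat \<Rightarrow> real) v.
        (\<forall>k<n. u k \<le> v k \<and> {u k..v k} \<subseteq> S) \<and>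
        disjoint_family_on (\<lambda>k. {u k<..<v k}) {..<n} \<and>
        (\<Sum>k<n. v k - u k) < \<delta>
        \<longrightarrow> (\<Sum>k<n. norm (f (v k) - f (u k))) < \<epsilon>)"

definition locally_abs_cont_on :: "real set \<Rightarrow> (real \<Rightarrow> 'a::real_normed_vector) \<Rightarrow> bool" where
  "locally_abs_cont_on S f \<longleftrightarrow> (\<forall>b c. {b..c} \<subseteq> S \<longrightarrow> abs_cont_on {b..c} f)"

text \<open>A solution is represented by a total function, of which only the values on
  \<open>{t0 - \<sigma>..}\<close> matter. At each \<open>t > t0\<close> the two-sided derivative is used.\<close>

definition is_solution ::
  "(2 \<Rightarrow> real \<Rightarrow> real) \<Rightarrow> (2 \<Rightarrow> 2 \<Rightarrow> real \<Rightarrow> real \<Rightarrow> real) \<Rightarrow> (2 \<Rightarrow> real \<Rightarrow> real) \<Rightarrow>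
   (2 \<Rightarrow> 2 \<Rightarrow> real \<Rightarrow> real) \<Rightarrow> real \<Rightarrow> real \<Rightarrow> (real \<Rightarrow> real^2) \<Rightarrow> (real \<Rightarrow> real^2) \<Rightarrow> bool" where
  "is_solution a F h g \<sigma> t0 \<phi> X \<longleftrightarrow>
     locally_abs_cont_on {t0..} X \<and>
     (AE t in lebesgue_on {t0<..}. \<forall>i.
        ((\<lambda>s. X s $ i) has_real_derivative
           - a i t * X (h i t) $ i + (\<Sum>j\<in>UNIV. F i j t (X (g i j t) $ j))) (at t)) \<and>
     (\<forall>t\<in>{t0 - \<sigma>..t0}. X t = \<phi> t)"

definition unique_solvability ::
  "(2 \<Rightarrow> real \<Rightarrow> real) \<Rightarrow> (2 \<Rightarrow> 2 \<Rightarrow> real \<Rightarrow> real \<Rightarrow> real) \<Rightarrow> (2 \<Rightarrow> real \<Rightarrow> real) \<Rightarrow>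
   (2 \<Rightarrow> 2 \<Rightarrow> real \<Rightarrow> real) \<Rightarrow> real \<Rightarrow> bool" where
  "unique_solvability a F h g \<sigma> \<longleftrightarrow>
     (\<forall>t0\<ge>0. \<forall>\<phi>. continuous_on {t0 - \<sigma>..t0} \<phi> \<longrightarrow>
        (\<exists>X. is_solution a F h g \<sigma> t0 \<phi> X \<and>
             (\<forall>Y. is_solution a F h g \<sigma> t0 \<phi> Y \<longrightarrow> (\<forall>t\<ge>t0 - \<sigma>. Y t = X t))))"

text \<open>\<^term>\<open>Sup {} :: real\<close> is an unspecified value, so the convention that an
  empty supremum is zero has to be made explicit; it applies when \<open>\<sigma> = 0\<close>.\<close>

definition sup0 :: "real set \<Rightarrow> real" where
  "sup0 S = (if S = {} then 0 else Sup S)"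

definition globally_exponentially_stable ::
  "(real^2 \<Rightarrow> real) \<Rightarrow> (2 \<Rightarrow> real \<Rightarrow> real) \<Rightarrow> (2 \<Rightarrow> 2 \<Rightarrow> real \<Rightarrow> real \<Rightarrow> real) \<Rightarrow>
   (2 \<Rightarrow> real \<Rightarrow> real) \<Rightarrow> (2 \<Rightarrow> 2 \<Rightarrow> real \<Rightarrow> real) \<Rightarrow> real \<Rightarrow> bool" where
  "globally_exponentially_stable N a F h g \<sigma> \<longleftrightarrow>
     (\<exists>M>0. \<exists>\<gamma>>0. \<forall>t0\<ge>0. \<forall>\<phi> X.
        continuous_on {t0 - \<sigma>..t0} \<phi> \<longrightarrow> is_solution a F h g \<sigma> t0 \<phi> X \<longrightarrow>
        (\<forall>t\<ge>t0. N (X t) \<le> M * exp (- \<gamma> * (t - t0)) *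
           (N (X t0) + sup0 ((\<lambda>s. N (\<phi> s)) ` {t0 - \<sigma>..<t0}))))"

end

theory Submission
  imports Defs
begin

text \<open>
  The delay in the damping term is removed by writing
  \<open>x\<^sub>i(h\<^sub>i(t)) = x\<^sub>i(t) - (x\<^sub>i(t) - x\<^sub>i(h\<^sub>i(t)))\<close> and bounding the correction by \<open>\<tau>\<^sub>i\<close> times the
  largest derivative on the last stretch of length \<open>\<tau>\<^sub>i\<close>, which the equation itself bounds by
  \<open>A\<^sub>i R\<^sub>i + \<Sum>\<^sub>j L\<^sub>i\<^sub>j R\<^sub>j\<close> when \<open>R\<^sub>j\<close> bounds \<open>\<bar>x\<^sub>j\<bar>\<close> over the last \<open>2\<sigma>\<close> time units. Where
  \<open>x\<^sub>i \<ge> 0\<close> this gives a differential inequality with pure damping,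
  \<open>x\<^sub>i' \<le> -\<alpha>\<^sub>i x\<^sub>i + A\<^sub>i \<tau>\<^sub>i (A\<^sub>i R\<^sub>i + \<Sum>\<^sub>j L\<^sub>i\<^sub>j R\<^sub>j) + \<Sum>\<^sub>j L\<^sub>i\<^sub>j R\<^sub>j\<close>, and the mirror image of it
  where \<open>x\<^sub>i \<le> 0\<close> (\<open>damped_derivative_le\<close>).

  The hypotheses on the coefficients say that a two by two matrix with nonpositive off-diagonal
  entries has a positive leading entry and a positive determinant. Hence there are weights
  \<open>w\<^sub>i > 0\<close> for which the right-hand side is negative when \<open>x\<^sub>i = R\<^sub>i\<close> and \<open>R = w\<close>
  (\<open>positive_weights\<close>). By continuity this survives a small exponential rate: for small \<open>\<gamma>\<close>,
  a solution that has stayed below the barriers \<open>P w\<^sub>j exp (-\<gamma>(t - t\<^sub>0))\<close> and touches the \<open>i\<close>-th one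
  has a slope below the slope of that barrier. But a function that reaches a barrier for the first
  time must have arrived there at least as steeply as the barrier. So the barriers are never
  reached (\<open>strictly_below_barrier\<close>, \<open>decay_bound\<close>).

  The damped inequality looks back over \<open>2\<sigma>\<close> and needs the equation to hold on the
  last \<open>\<sigma>\<close> of that stretch, so the decay argument can start only at \<open>t\<^sub>0 + \<sigma>\<close>. The factor \<open>P\<close> that
  makes the barriers high enough up to that time is proportional to the size of the initial data,
  because on bounded time intervals the solution grows at most exponentially (\<open>growth_bound\<close>), by the
  same barrier principle.

  As the equation holds only almost everywhere, the comparison of slopes rests on the fact
  that an absolutely continuous function whose derivative is at most \<open>c\<close> outside a null set
  increases with slope at most \<open>c\<close> (\<open>abs_cont_on_increment_le\<close>).
\<close>

section \<open>Absolutely continuous functions\<close>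

lemma abs_cont_on_imp_continuous_on:
  fixes f :: "real \<Rightarrow> 'a::real_normed_vector"
  assumes "abs_cont_on {a..b} f"
  shows "continuous_on {a..b} f"
  unfolding continuous_on_iff
proof (intro ballI allI impI)
  fix x e :: real
  assume x: "x \<in> {a..b}" and "0 < e"
  then obtain d where "d > 0" and d: "\<And>n (u::nat \<Rightarrow> real) v.
        (\<forall>k<n. u k \<le> v k \<and> {u k..v k} \<subseteq> {a..b}) \<and>
        disjoint_family_on (\<lambda>k. {u k<..<v k}) {..<n} \<and>
        (\<Sum>k<n. v k - u k) < d
        \<longrightarrow> (\<Sum>k<n. norm (f (v k) - f (u k))) < e"
    using assms unfolding abs_cont_on_def by meson
  have "dist (f y) (f x) < e" if y: "y \<in> {a..b}" "dist y x < d" for y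
  proof -
    have "norm (f (max x y) - f (min x y)) < e"
      using d[of 1 "\<lambda>_. min x y" "\<lambda>_. max x y"] x y
      by (auto simp: disjoint_family_on_def dist_real_def)
    then show ?thesis
      by (auto simp: dist_norm max_def min_def norm_minus_commute split: if_splits)
  qed
  then show "\<exists>d>0. \<forall>y\<in>{a..b}. dist y x < d \<longrightarrow> dist (f y) (f x) < e"
    using \<open>d > 0\<close> by blast
qed

lemma abs_cont_on_subset: "abs_cont_on S f \<Longrightarrow> T \<subseteq> S \<Longrightarrow> abs_cont_on T f"
  unfolding abs_cont_on_def by (meson subset_trans)

text \<open>Coordinates and multiples by a sign inherit absolute continuity because they do not
  enlarge increments.\<close>

lemma abs_cont_on_norm_le:
  assumes "abs_cont_on S f"
    and le: "\<And>s t. norm (p t - p s) \<le> norm (f t - f s)"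
  shows "abs_cont_on S p"
  unfolding abs_cont_on_def
proof (intro allI impI)
  fix \<epsilon> :: real
  assume "\<epsilon> > 0"
  then obtain d where "d > 0" and d: "\<And>n (u::nat \<Rightarrow> real) v.
        (\<forall>k<n. u k \<le> v k \<and> {u k..v k} \<subseteq> S) \<and>
        disjoint_family_on (\<lambda>k. {u k<..<v k}) {..<n} \<and>
        (\<Sum>k<n. v k - u k) < d
        \<longrightarrow> (\<Sum>k<n. norm (f (v k) - f (u k))) < \<epsilon>"
    using assms(1) unfolding abs_cont_on_def by meson
  show "\<exists>\<delta>>0. \<forall>n (u::nat \<Rightarrow> real) v.
        (\<forall>k<n. u k \<le> v k \<and> {u k..v k} \<subseteq> S) \<and>
        disjoint_family_on (\<lambda>k. {u k<..<v k}) {..<n} \<and>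
        (\<Sum>k<n. v k - u k) < \<delta>
        \<longrightarrow> (\<Sum>k<n. norm (p (v k) - p (u k))) < \<epsilon>"
  proof (intro exI[of _ d] conjI allI impI)
    fix n and u v :: "nat \<Rightarrow> real"
    assume "(\<forall>k<n. u k \<le> v k \<and> {u k..v k} \<subseteq> S) \<and>
        disjoint_family_on (\<lambda>k. {u k<..<v k}) {..<n} \<and> (\<Sum>k<n. v k - u k) < d"
    then have "(\<Sum>k<n. norm (f (v k) - f (u k))) < \<epsilon>"
      using d by blast
    moreover have "(\<Sum>k<n. norm (p (v k) - p (u k))) \<le> (\<Sum>k<n. norm (f (v k) - f (u k)))"
      by (intro sum_mono le)
    ultimately show "(\<Sum>k<n. norm (p (v k) - p (u k))) < \<epsilon>"
      by linarith
  qed fact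
qed

text \<open>The numbered intervals of the definition may be indexed by any finite set; below, they
  are the tagged intervals of a division.\<close>

lemma abs_cont_on_finite_family:
  assumes f: "abs_cont_on S f" and "\<epsilon> > 0"
  shows "\<exists>\<delta>>0. \<forall>I (u :: 'i \<Rightarrow> real) v.
        finite I \<and> (\<forall>k\<in>I. u k \<le> v k \<and> {u k..v k} \<subseteq> S) \<and>
        disjoint_family_on (\<lambda>k. {u k<..<v k}) I \<and> (\<Sum>k\<in>I. v k - u k) < \<delta>
      \<longrightarrow> (\<Sum>k\<in>I. norm (f (v k) - f (u k))) < \<epsilon>"
proof -
  obtain d where "d > 0" and d: "\<And>n (u::nat \<Rightarrow> real) v.
        (\<forall>k<n. u k \<le> v k \<and> {u k..v k} \<subseteq> S) \<and>
        disjoint_family_on (\<lambda>k. {u k<..<v k}) {..<n} \<and>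
        (\<Sum>k<n. v k - u k) < d
        \<longrightarrow> (\<Sum>k<n. norm (f (v k) - f (u k))) < \<epsilon>"
    using assms unfolding abs_cont_on_def by meson
  show ?thesis
  proof (intro exI[of _ d] conjI allI impI)
    fix I and u v :: "'i \<Rightarrow> real"
    assume "finite I \<and> (\<forall>k\<in>I. u k \<le> v k \<and> {u k..v k} \<subseteq> S) \<and>
        disjoint_family_on (\<lambda>k. {u k<..<v k}) I \<and> (\<Sum>k\<in>I. v k - u k) < d"
    then have I: "finite I" "\<And>k. k \<in> I \<Longrightarrow> u k \<le> v k \<and> {u k..v k} \<subseteq> S"
      "disjoint_family_on (\<lambda>k. {u k<..<v k}) I" "(\<Sum>k\<in>I. v k - u k) < d"
      by blast+
    obtain e where e: "bij_betw e {..<card I} I"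
      using ex_bij_betw_nat_finite[OF I(1)] by (auto simp: lessThan_atLeast0)
    have "(\<Sum>k<card I. norm (f (v (e k)) - f (u (e k)))) < \<epsilon>"
    proof (rule d[rule_format], intro conjI allI impI)
      fix k assume "k < card I"
      then have "e k \<in> I"
        using e by (auto simp: bij_betw_def)
      then show "u (e k) \<le> v (e k)" "{u (e k)..v (e k)} \<subseteq> S"
        using I(2) by auto
    next
      show "disjoint_family_on (\<lambda>k. {u (e k)<..<v (e k)}) {..<card I}"
        unfolding disjoint_family_on_def
      proof (intro ballI impI)
        fix m n assume "m \<in> {..<card I}" "n \<in> {..<card I}" "m \<noteq> n"
        then have "e m \<in> I" "e n \<in> I" "e m \<noteq> e n"
          using e by (auto simp: bij_betw_def inj_on_def)
        then show "{u (e m)<..<v (e m)} \<inter> {u (e n)<..<v (e n)} = {}"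
          using I(3) unfolding disjoint_family_on_def by blast
      qed
      show "(\<Sum>k<card I. v (e k) - u (e k)) < d"
        using I(4) sum.reindex_bij_betw[OF e, of "\<lambda>k. v k - u k"] by simp
    qed
    then show "(\<Sum>k\<in>I. norm (f (v k) - f (u k))) < \<epsilon>"
      using sum.reindex_bij_betw[OF e, of "\<lambda>k. norm (f (v k) - f (u k))"] by simp
  qed fact
qed

text \<open>The increment is taken between points on the two sides of \<open>x\<close>. This is what the intervals
  of a tagged division, which contain their tags, require.\<close>

lemma straddle_upper_bound:
  fixes f :: "real \<Rightarrow> real"
  assumes "(f has_real_derivative D) (at x)" "D \<le> c" "\<epsilon> > 0"
  obtains d where "d > 0"
    "\<And>u v. \<lbrakk>u \<le> x; x \<le> v; x - u < d; v - x < d\<rbrakk> \<Longrightarrow> f v - f u \<le> (c + \<epsilon>) * (v - u)"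
proof -
  have "(f has_derivative (\<lambda>h. D * h)) (at x)"
    using assms(1) by (simp add: has_field_derivative_def)
  then obtain d where "d > 0" and
    d: "\<And>y. \<bar>y - x\<bar> < d \<Longrightarrow> \<bar>f y - f x - D * (y - x)\<bar> \<le> \<epsilon> * \<bar>y - x\<bar>"
    using \<open>\<epsilon> > 0\<close> unfolding has_derivative_at_alt by (metis real_norm_def)
  show thesis
  proof (rule that[OF \<open>d > 0\<close>])
    fix u v
    assume uv: "u \<le> x" "x \<le> v" "x - u < d" "v - x < d"
    have "f v - f x - D * (v - x) \<le> \<epsilon> * (v - x)"
      using d[of v] uv by auto
    moreover have "f x - f u - D * (x - u) \<le> \<epsilon> * (x - u)"
      using d[of u] uv by (simp add: abs_le_iff algebra_simps)
    ultimately have "f v - f u \<le> (D + \<epsilon>) * (v - u)"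
      by (simp add: algebra_simps)
    also have "\<dots> \<le> (c + \<epsilon>) * (v - u)"
      using uv assms(2) by (intro mult_right_mono) auto
    finally show "f v - f u \<le> (c + \<epsilon>) * (v - u)" .
  qed
qed

text \<open>Take a tagged division of \<open>{a..b}\<close> that is fine enough. An interval whose tag lies
  outside the null set contributes at most \<open>c + \<epsilon>\<close> times its length, by differentiability at the
  tag. The intervals tagged in the null set have small total length, because the
  indicator function of that set has gauge integral \<open>0\<close>; by absolute continuity their contribution
  is small too.\<close>

lemma abs_cont_on_increment_le:
  fixes f :: "real \<Rightarrow> real"
  assumes f: "abs_cont_on {a..b} f" and "a \<le> b" and E: "negligible E"
    and der: "\<And>t. t \<in> {a<..<b} - E \<Longrightarrow> \<exists>D\<le>c. (f has_real_derivative D) (at t)"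
  shows "f b - f a \<le> c * (b - a)"
proof -
  \<comment> \<open>The derivative at the endpoints is unknown, and a tag may be an endpoint.\<close>
  define E' where "E' = E \<union> {a, b}"
  have E': "negligible E'"
    unfolding E'_def by (intro negligible_Un E) (simp add: negligible_finite)
  \<comment> \<open>The slack collects three errors: the bad increments, the \<open>\<epsilon>\<close> in the good slopes, and the
      length missing from the good intervals.\<close>
  have approx: "f b - f a \<le> c * (b - a) + \<epsilon> * ((b - a) + \<bar>c\<bar> + 1)" if "\<epsilon> > 0" for \<epsilon>
  proof -
    obtain \<delta>' where "\<delta>' > 0" and \<delta>': "\<And>I (u :: real \<times> real set \<Rightarrow> real) v.
        finite I \<and> (\<forall>k\<in>I. u k \<le> v k \<and> {u k..v k} \<subseteq> {a..b}) \<and>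
        disjoint_family_on (\<lambda>k. {u k<..<v k}) I \<and> (\<Sum>k\<in>I. v k - u k) < \<delta>'
      \<Longrightarrow> (\<Sum>k\<in>I. norm (f (v k) - f (u k))) < \<epsilon>"
      using abs_cont_on_finite_family[OF f \<open>\<epsilon> > 0\<close>] by blast
    define \<delta> where "\<delta> = min \<delta>' \<epsilon>"
    have "\<delta> > 0"
      using \<open>\<delta>' > 0\<close> \<open>\<epsilon> > 0\<close> by (simp add: \<delta>_def)
    have "(indicat_real E' has_integral 0) (cbox a b)"
      using E' unfolding negligible_def by blast
    then obtain \<gamma> where "gauge \<gamma>" and \<gamma>:
      "\<And>\<D>. \<lbrakk>\<D> tagged_division_of cbox a b; \<gamma> fine \<D>\<rbrakk> \<Longrightarrow>
          norm ((\<Sum>(x,k)\<in>\<D>. measure lborel k *\<^sub>R indicat_real E' x) - 0) < \<delta>"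
      using \<open>\<delta> > 0\<close> unfolding has_integral by meson
    define straddle where "straddle x d \<longleftrightarrow> (\<forall>u v. u \<le> x \<longrightarrow> x \<le> v \<longrightarrow> x - u < d \<longrightarrow> v - x < d
        \<longrightarrow> f v - f u \<le> (c + \<epsilon>) * (v - u))" for x d
    have "\<exists>d>0. x \<in> {a..b} - E' \<longrightarrow> straddle x d" for x
    proof (cases "x \<in> {a..b} - E'")
      case True
      then have "x \<in> {a<..<b} - E"
        by (auto simp: E'_def)
      then obtain D where "D \<le> c" "(f has_real_derivative D) (at x)"
        using der by blast
      then show ?thesis
        using straddle_upper_bound[of f D x c \<epsilon>] \<open>\<epsilon> > 0\<close> unfolding straddle_def by metis
    next
      case False
      then show ?thesis
        by (intro exI[of _ 1]) auto
    qed
    then obtain r where r: "\<And>x. r x > 0" "\<And>x. x \<in> {a..b} - E' \<Longrightarrow> straddle x (r x)"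
      by metis
    have "gauge (\<lambda>x. \<gamma> x \<inter> ball x (r x))"
      using \<open>gauge \<gamma>\<close> r(1) by (intro gauge_Int gauge_ball_dependent) auto
    then obtain p where p: "p tagged_division_of cbox a b" and fine: "(\<lambda>x. \<gamma> x \<inter> ball x (r x)) fine p"
      using fine_division_exists by blast
    note pD = tagged_division_ofD[OF p]
    \<comment> \<open>A closed real interval is recovered from its infimum and supremum, which makes it available
        to absolute continuity.\<close>
    have shape: "k = {Inf k..Sup k} \<and> Inf k \<le> x \<and> x \<le> Sup k \<and> {Inf k..Sup k} \<subseteq> {a..b} \<and> measure lborel k = Sup k - Inf k
        \<and> interior k = {Inf k<..<Sup k}"
      if xk: "(x, k) \<in> p" for x k
    proof -
      obtain u v where k: "k = {u..v}"
        using pD(4)[OF xk] by (auto simp: cbox_interval)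
      moreover have "x \<in> k" "k \<subseteq> {a..b}"
        using pD(2,3)[OF xk] by (auto simp: cbox_interval)
      ultimately show ?thesis
        by auto
    qed
    define q where "q = {xk \<in> p. fst xk \<in> E'}"
    have "finite p" "q \<subseteq> p" "finite q"
      using pD(1) by (auto simp: q_def)
    \<comment> \<open>The length of the badly tagged intervals is a Riemann sum for the indicator of the null set.\<close>
    have len: "(\<Sum>xk\<in>q. Sup (snd xk) - Inf (snd xk)) < \<delta>"
    proof -
      have "(\<Sum>xk\<in>q. Sup (snd xk) - Inf (snd xk)) = (\<Sum>(x,k)\<in>p. measure lborel k *\<^sub>R indicat_real E' x)"
        unfolding q_def using \<open>finite p\<close> shape
        by (subst sum.inter_filter) (auto intro!: sum.cong simp: indicator_def split: prod.splits)
      also have "\<dots> < \<delta>"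
        using \<gamma>[OF p] fine by (simp add: fine_Int)
      finally show ?thesis .
    qed
    have "disjoint_family_on (\<lambda>xk. {Inf (snd xk)<..<Sup (snd xk)}) q"
      unfolding disjoint_family_on_def
    proof (intro ballI impI)
      fix y z assume yz: "y \<in> q" "z \<in> q" "y \<noteq> z"
      obtain x k x' k' where eq: "y = (x, k)" "z = (x', k')"
        by fastforce
      have "interior k \<inter> interior k' = {}"
        using pD(5)[of x k x' k'] yz eq \<open>q \<subseteq> p\<close> by auto
      moreover have "(x, k) \<in> p" "(x', k') \<in> p"
        using yz eq \<open>q \<subseteq> p\<close> by auto
      ultimately show "{Inf (snd y)<..<Sup (snd y)} \<inter> {Inf (snd z)<..<Sup (snd z)} = {}"
        using shape[of x k] shape[of x' k'] by (simp add: eq)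
    qed
    moreover have "Inf (snd xk) \<le> Sup (snd xk) \<and> {Inf (snd xk)..Sup (snd xk)} \<subseteq> {a..b}" if "xk \<in> q" for xk
      using shape[of "fst xk" "snd xk"] that \<open>q \<subseteq> p\<close> by (metis order_trans prod.collapse subsetD)
    ultimately have bad: "(\<Sum>xk\<in>q. \<bar>f (Sup (snd xk)) - f (Inf (snd xk))\<bar>) < \<epsilon>"
      using \<delta>'[of q "\<lambda>xk. Inf (snd xk)" "\<lambda>xk. Sup (snd xk)"] len \<open>finite q\<close> by (simp add: \<delta>_def)
    have good: "(\<Sum>xk\<in>p - q. f (Sup (snd xk)) - f (Inf (snd xk)))
        \<le> (\<Sum>xk\<in>p - q. (c + \<epsilon>) * (Sup (snd xk) - Inf (snd xk)))"
    proof (rule sum_mono)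
      fix y assume y: "y \<in> p - q"
      obtain x k where eq: "y = (x, k)"
        by fastforce
      have xk: "(x, k) \<in> p" "x \<notin> E'"
        using y eq by (auto simp: q_def)
      then have "k \<subseteq> ball x (r x)"
        using fine by (auto simp: fine_def)
      moreover note shape[OF xk(1)]
      moreover have "Inf k \<in> k" "Sup k \<in> k"
        using shape[OF xk(1)] atLeastAtMost_iff[of _ "Inf k" "Sup k"] by auto
      ultimately have "x - Inf k < r x" "Sup k - x < r x" "x \<in> {a..b} - E'"
        using xk pD(2,3)[OF xk(1)] by (auto simp: dist_real_def subset_iff)
      then show "f (Sup (snd y)) - f (Inf (snd y)) \<le> (c + \<epsilon>) * (Sup (snd y) - Inf (snd y))"
        using r(2) shape[OF xk(1)] eq by (simp add: straddle_def)
    qed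
    have telescope: "(\<Sum>xk\<in>p. G (Sup (snd xk)) - G (Inf (snd xk))) = G b - G a" for G :: "real \<Rightarrow> real"
      using additive_tagged_division_1[OF \<open>a \<le> b\<close>, of p G] p
      by (simp add: cbox_interval case_prod_unfold)
    have split: "(\<Sum>xk\<in>p. G xk) = (\<Sum>xk\<in>q. G xk) + (\<Sum>xk\<in>p - q. G xk)" for G :: "real \<times> real set \<Rightarrow> real"
      using sum.subset_diff[OF \<open>q \<subseteq> p\<close> \<open>finite p\<close>, of G] by simp
    define l where "l = (\<Sum>xk\<in>q. Sup (snd xk) - Inf (snd xk))"
    have l: "0 \<le> l" "l \<le> \<epsilon>"
      using len shape \<open>q \<subseteq> p\<close> by (force simp: l_def \<delta>_def intro!: sum_nonneg)+
    have "f b - f a \<le> (\<Sum>xk\<in>q. \<bar>f (Sup (snd xk)) - f (Inf (snd xk))\<bar>)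
        + (\<Sum>xk\<in>p - q. f (Sup (snd xk)) - f (Inf (snd xk)))"
      unfolding telescope[of f, symmetric] split by (intro add_right_mono sum_mono) auto
    also have "\<dots> \<le> \<epsilon> + (\<Sum>xk\<in>p - q. (c + \<epsilon>) * (Sup (snd xk) - Inf (snd xk)))"
      using bad good by linarith
    also have "(\<Sum>xk\<in>p - q. (c + \<epsilon>) * (Sup (snd xk) - Inf (snd xk))) = (c + \<epsilon>) * ((b - a) - l)"
      using telescope[of "\<lambda>x. x"] split[of "\<lambda>xk. Sup (snd xk) - Inf (snd xk)"]
      by (simp add: l_def sum_distrib_left[symmetric])
    also have "\<dots> \<le> c * (b - a) + \<epsilon> * (b - a) + \<bar>c\<bar> * \<epsilon>"
    proof -
      have "- c * l \<le> \<bar>c\<bar> * \<epsilon>"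
        using l by (intro mult_mono) auto
      moreover have "\<epsilon> * l \<ge> 0"
        using l \<open>\<epsilon> > 0\<close> by simp
      ultimately show ?thesis
        by (simp add: algebra_simps)
    qed
    finally show ?thesis
      by (simp add: algebra_simps)
  qed
  show ?thesis
  proof (rule field_le_epsilon)
    fix e :: real assume "e > 0"
    have pos: "(b - a) + \<bar>c\<bar> + 1 > 0"
      using \<open>a \<le> b\<close> by linarith
    then show "f b - f a \<le> c * (b - a) + e"
      using approx[of "e / ((b - a) + \<bar>c\<bar> + 1)"] \<open>e > 0\<close> by simp
  qed
qed

lemma abs_cont_on_increment_abs_le:
  fixes f :: "real \<Rightarrow> real"
  assumes f: "abs_cont_on {a..b} f" and "a \<le> b" and E: "negligible E"
    and der: "\<And>t. t \<in> {a<..<b} - E \<Longrightarrow> (f has_real_derivative D t) (at t)"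
    and D: "\<And>t. t \<in> {a<..<b} - E \<Longrightarrow> \<bar>D t\<bar> \<le> c"
  shows "\<bar>f b - f a\<bar> \<le> c * (b - a)"
proof -
  have "f b - f a \<le> c * (b - a)"
    using der D by (intro abs_cont_on_increment_le[OF f \<open>a \<le> b\<close> E]) (meson abs_le_D1)
  moreover have "- f b - - f a \<le> c * (b - a)"
  proof (rule abs_cont_on_increment_le[OF _ \<open>a \<le> b\<close> E])
    show "abs_cont_on {a..b} (\<lambda>t. - f t)"
      by (rule abs_cont_on_norm_le[OF f]) simp
    show "\<exists>D\<le>c. ((\<lambda>t. - f t) has_real_derivative D) (at t)" if "t \<in> {a<..<b} - E" for t
      using DERIV_minus[OF der[OF that]] D[OF that] by (meson abs_le_D2)
  qed
  ultimately show ?thesis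
    by linarith
qed

section \<open>First contact with a barrier\<close>

text \<open>Going back in time from the contact point \<open>t\<close>, the barrier falls faster than rate \<open>c\<close>
  and the function at most at rate \<open>c\<close>. So just before \<open>t\<close> the function lies above the barrier.\<close>

lemma crossing_of_steeper_barrier:
  fixes y b :: "real \<Rightarrow> real"
  assumes cont: "abs_cont_on {T..t} y" and "T < t" and E: "negligible E"
    and der: "\<And>u. u \<in> {T<..<t} - E \<Longrightarrow> (y has_real_derivative y' u) (at u)"
    and b: "(b has_real_derivative b') (at t)" and "y t = b t"
    and slope: "\<forall>\<^sub>F u in at_left t. u \<notin> E \<longrightarrow> y' u \<le> c" and "c < b'"
  shows "\<exists>u\<in>{T<..<t}. b u < y u"
proof -
  have "((\<lambda>u. (b u - b t) / (u - t)) \<longlongrightarrow> b') (at_left t)"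
    using b unfolding has_field_derivative_iff
    by (rule filterlim_mono) (auto simp: at_within_le_at)
  then have "\<forall>\<^sub>F u in at_left t. c < (b u - b t) / (u - t)"
    using \<open>c < b'\<close> by (rule order_tendstoD)
  moreover have "\<forall>\<^sub>F u in at_left t. u \<in> {T<..<t}"
    using \<open>T < t\<close> by (rule eventually_at_left_real)
  ultimately have "\<forall>\<^sub>F u in at_left t. c < (b u - b t) / (u - t) \<and> u \<in> {T<..<t} \<and> (u \<notin> E \<longrightarrow> y' u \<le> c)"
    using slope by (simp add: eventually_conj_iff)
  then obtain r where "r < t" and
    r: "\<And>u. \<lbrakk>r < u; u < t\<rbrakk> \<Longrightarrow> c < (b u - b t) / (u - t) \<and> u \<in> {T<..<t} \<and> (u \<notin> E \<longrightarrow> y' u \<le> c)"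
    unfolding eventually_at_left_field by blast
  define u where "u = (r + t) / 2"
  have u: "r < u" "u < t"
    using \<open>r < t\<close> by (auto simp: u_def)
  have "y t - y u \<le> c * (t - u)"
  proof (rule abs_cont_on_increment_le[OF _ _ E])
    show "abs_cont_on {u..t} y"
      using cont r[OF u] by (intro abs_cont_on_subset[OF cont]) auto
    show "\<exists>D\<le>c. (y has_real_derivative D) (at s)" if "s \<in> {u<..<t} - E" for s
      using that r[of s] u der[of s] by auto
  qed (use u in auto)
  moreover have "b u < b t - c * (t - u)"
    using r[OF u] u by (simp add: less_divide_eq algebra_simps)
  ultimately have "b u < y u"
    using \<open>y t = b t\<close> by linarith
  then show ?thesis
    using r[OF u] by blast
qed

text \<open>At the first contact of some \<open>\<bar>x\<^sub>i\<bar>\<close> with its barrier the hypothesis \<open>touch\<close> applies, since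
  no barrier has been crossed before; it makes \<open>s * x\<^sub>i\<close> less steep than the barrier, and the
  previous lemma puts it above the barrier at an earlier time, a contradiction. The sign \<open>s\<close> treats contact
  from below and from above together. The past on \<open>{T0..T}\<close>, where the derivatives of \<open>x\<close> are not constrained,
  enters because a delay system can look back to it.\<close>

lemma strictly_below_barrier:
  fixes x x' b b' :: "'n::finite \<Rightarrow> real \<Rightarrow> real"
  assumes ac: "\<And>i. locally_abs_cont_on {T..} (x i)" and E: "negligible E"
    and der: "\<And>i t. \<lbrakk>T < t; t \<notin> E\<rbrakk> \<Longrightarrow> (x i has_real_derivative x' i t) (at t)"
    and b: "\<And>i t. (b i has_real_derivative b' i t) (at t)"
    and init: "\<And>i t. \<lbrakk>T0 \<le> t; t \<le> T\<rbrakk> \<Longrightarrow> \<bar>x i t\<bar> < b i t" and "T0 \<le> T"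
    and touch: "\<And>i t s. \<lbrakk>T < t; s \<in> {1, -1}; \<And>j u. \<lbrakk>T0 \<le> u; u \<le> t\<rbrakk> \<Longrightarrow> \<bar>x j u\<bar> \<le> b j u; s * x i t = b i t\<rbrakk>
      \<Longrightarrow> \<exists>c < b' i t. \<forall>\<^sub>F u in at_left t. u \<notin> E \<longrightarrow> s * x' i u \<le> c"
    and t: "T0 \<le> t"
  shows "\<bar>x i t\<bar> < b i t"
proof (rule ccontr)
  assume neg: "\<not> \<bar>x i t\<bar> < b i t"
  have acT: "abs_cont_on {T..r} (x j)" for j r
    using ac[of j] unfolding locally_abs_cont_on_def by auto
  define S where "S = {u \<in> {T..t}. \<exists>j. b j u \<le> \<bar>x j u\<bar>}"
  have "T < t"
    using neg init t by force
  then have "t \<in> S"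
    using neg by (auto simp: S_def not_less)
  have contb: "continuous_on A (b j)" for A j
    using b by (meson DERIV_isCont continuous_at_imp_continuous_on)
  have "closed {u \<in> {T..t}. b j u \<le> \<bar>x j u\<bar>}" for j
    using abs_cont_on_imp_continuous_on[OF acT] contb
    by (intro continuous_on_closed_Collect_le continuous_intros) auto
  moreover have "S = (\<Union>j. {u \<in> {T..t}. b j u \<le> \<bar>x j u\<bar>})"
    by (auto simp: S_def)
  ultimately have "closed S"
    by auto
  define r where "r = Inf S"
  have "bdd_below S"
    by (auto simp: S_def intro: bdd_belowI[of _ T])
  then have "r \<in> S"
    unfolding r_def using \<open>t \<in> S\<close> \<open>closed S\<close> by (intro closed_contains_Inf) auto
  then obtain j where j: "b j r \<le> \<bar>x j r\<bar>" "T \<le> r"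
    by (auto simp: S_def)
  then have "T < r"
    using init[of r j] \<open>T0 \<le> T\<close> by (cases "r = T") auto
  have before: "\<bar>x k u\<bar> < b k u" if "T0 \<le> u" "u < r" for k u
  proof (cases "u \<le> T")
    case False
    have "u \<notin> S"
      using cInf_lower[OF _ \<open>bdd_below S\<close>, of u] that by (auto simp: r_def)
    moreover have "u \<in> {T..t}"
      using False that \<open>r \<in> S\<close> by (auto simp: S_def)
    ultimately show ?thesis
      by (auto simp: S_def not_le)
  qed (use init that in auto)
  have at_r: "\<bar>x k r\<bar> \<le> b k r" for k
  proof (rule tendsto_le[of "at_left r"])
    have "continuous_on {T..r} (\<lambda>u. \<bar>x k u\<bar>)"
      using abs_cont_on_imp_continuous_on[OF acT] by (intro continuous_intros)
    then show "((\<lambda>u. \<bar>x k u\<bar>) \<longlongrightarrow> \<bar>x k r\<bar>) (at_left r)"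
      using \<open>T < r\<close> by (intro continuous_on_Icc_at_leftD) 
    show "(b k \<longlongrightarrow> b k r) (at_left r)"
      using DERIV_isCont[OF b] by (simp add: filterlim_at_split isCont_def)
    show "\<forall>\<^sub>F u in at_left r. \<bar>x k u\<bar> \<le> b k u"
      using eventually_at_left_real[OF \<open>T < r\<close>]
      by eventually_elim (use before \<open>T0 \<le> T\<close> in \<open>force intro: less_imp_le\<close>)
  qed simp
  have "\<bar>x j r\<bar> = b j r"
    using at_r[of j] j by simp
  then obtain s :: real where s: "s \<in> {1, -1}" "s * x j r = b j r"
    by (metis abs_real_def insertCI mult_1 mult_minus1)
  have "\<bar>x k u\<bar> \<le> b k u" if "T0 \<le> u" "u \<le> r" for k u
    using before[of u k] at_r[of k] that by (cases "u = r") auto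
  then obtain c where c: "c < b' j r" "\<forall>\<^sub>F u in at_left r. u \<notin> E \<longrightarrow> s * x' j u \<le> c"
    using touch[OF \<open>T < r\<close> s(1) _ s(2)] by blast
  have "\<exists>u\<in>{T<..<r}. b j u < s * x j u"
  proof (rule crossing_of_steeper_barrier[where y = "\<lambda>u. s * x j u" and y' = "\<lambda>u. s * x' j u",
        OF _ \<open>T < r\<close> E _ b s(2) c(2,1)])
    show "abs_cont_on {T..r} (\<lambda>u. s * x j u)"
      using s(1) by (intro abs_cont_on_norm_le[OF acT[of r j]]) auto
    show "((\<lambda>u. s * x j u) has_real_derivative s * x' j u) (at u)" if "u \<in> {T<..<r} - E" for u
      using der[of u j] that by (intro DERIV_cmult) auto
  qed
  then obtain u where "u \<in> {T<..<r}" "b j u < s * x j u"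
    by blast
  moreover have "s * x j u \<le> \<bar>x j u\<bar>"
    using s(1) by auto
  ultimately show False
    using before[of u j] \<open>T0 \<le> T\<close> by force
qed

section \<open>Solutions of the delay system\<close>

text \<open>One fixed solution with any finite number of components; the equation holds outside the
  null set \<open>E\<close>. The nonlinear terms enter through their values \<open>f i j t\<close> along the solution, so that all estimates
  are linear in \<open>x\<close>.\<close>

locale delay_solution =
  fixes x a h :: "'n::finite \<Rightarrow> real \<Rightarrow> real" and f g :: "'n \<Rightarrow> 'n \<Rightarrow> real \<Rightarrow> real"
    and A \<alpha> \<tau> :: "'n \<Rightarrow> real" and L :: "'n \<Rightarrow> 'n \<Rightarrow> real" and t0 \<sigma> :: real and E :: "real set"
  assumes ac: "\<And>i. locally_abs_cont_on {t0..} (x i)" and E: "negligible E"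
    and der: "\<And>i t. \<lbrakk>t0 < t; t \<notin> E\<rbrakk> \<Longrightarrow>
        (x i has_real_derivative - a i t * x i (h i t) + (\<Sum>j\<in>UNIV. f i j t)) (at t)"
    and a: "\<And>i t. t0 < t \<Longrightarrow> \<alpha> i \<le> a i t \<and> a i t \<le> A i"
    and f: "\<And>i j t. t0 < t \<Longrightarrow> \<bar>f i j t\<bar> \<le> L i j * \<bar>x j (g i j t)\<bar>"
    and h: "\<And>i t. t0 < t \<Longrightarrow> 0 \<le> t - h i t \<and> t - h i t \<le> \<tau> i"
    and g: "\<And>i j t. t0 < t \<Longrightarrow> 0 \<le> t - g i j t \<and> t - g i j t \<le> \<sigma>"
    and \<alpha>: "\<And>i. 0 < \<alpha> i" and L: "\<And>i j. 0 \<le> L i j" and \<tau>: "\<And>i. \<tau> i \<le> \<sigma>" and \<sigma>: "0 \<le> \<sigma>"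
begin

lemma A_nonneg: "0 \<le> A i"
  using a[of "t0 + 1" i] \<alpha>[of i] by linarith

lemma coupling_le:
  assumes "t0 < t" and R: "\<And>j u. \<lbrakk>t - \<sigma> \<le> u; u \<le> t\<rbrakk> \<Longrightarrow> \<bar>x j u\<bar> \<le> R j"
  shows "\<bar>\<Sum>j\<in>UNIV. f i j t\<bar> \<le> (\<Sum>j\<in>UNIV. L i j * R j)"
proof -
  have "\<bar>f i j t\<bar> \<le> L i j * R j" for j
  proof -
    have "\<bar>x j (g i j t)\<bar> \<le> R j"
      using g[OF \<open>t0 < t\<close>, of i j] by (intro R) auto
    then show ?thesis
      using f[OF \<open>t0 < t\<close>, of i j] L[of i j] by (meson mult_left_mono order_trans)
  qed
  then show ?thesis
    by (intro order_trans[OF sum_abs] sum_mono)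
qed

text \<open>This serves twice: for the growth estimate, and to bound the correction by which a damping
  term with delay differs from one without.\<close>

lemma derivative_le:
  assumes "t0 < t" and R: "\<And>j u. \<lbrakk>t - \<sigma> \<le> u; u \<le> t\<rbrakk> \<Longrightarrow> \<bar>x j u\<bar> \<le> R j"
  shows "\<bar>- a i t * x i (h i t) + (\<Sum>j\<in>UNIV. f i j t)\<bar> \<le> A i * R i + (\<Sum>j\<in>UNIV. L i j * R j)"
proof -
  have "\<bar>a i t * x i (h i t)\<bar> \<le> A i * R i"
    unfolding abs_mult using a[OF \<open>t0 < t\<close>, of i] \<alpha>[of i] h[OF \<open>t0 < t\<close>, of i] \<tau>[of i]
    by (intro mult_mono R) auto
  moreover note coupling_le[OF assms, of i]
  ultimately show ?thesis
    by linarith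
qed

text \<open>If a barrier with growth rate \<open>B + 1\<close> is touched at time \<open>u\<close>, all components are below its
  current value \<open>b u\<close>, as it is increasing, so the derivatives just before are at most \<open>B * b u\<close>, which is less than the
  slope \<open>(B + 1) * b u\<close>. The exponent is shifted by \<open>\<sigma>\<close> so that the barrier is at least \<open>K\<close> on the
  whole initial interval.\<close>

lemma growth_bound:
  assumes init: "\<And>i t. \<lbrakk>t0 - \<sigma> \<le> t; t \<le> t0\<rbrakk> \<Longrightarrow> \<bar>x i t\<bar> < K"
    and B: "\<And>i. A i + (\<Sum>j\<in>UNIV. L i j) \<le> B" and "t0 - \<sigma> \<le> t"
  shows "\<bar>x i t\<bar> < K * exp ((B + 1) * (t - t0 + \<sigma>))"
proof -
  define b where "b u = K * exp ((B + 1) * (u - t0 + \<sigma>))" for u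
  have "K > 0"
    using init[of t0 i] \<sigma> by simp
  have "B \<ge> 0"
    using B[of i] A_nonneg[of i] L sum_nonneg[of UNIV "L i"] by force
  have mono: "b u \<le> b v" if "u \<le> v" for u v
    using that \<open>K > 0\<close> \<open>B \<ge> 0\<close> by (simp add: b_def)
  have "\<bar>x i t\<bar> < b t"
  proof (rule strictly_below_barrier[where T = t0 and E = E and b = "\<lambda>i. b" and b' = "\<lambda>i u. (B + 1) * b u"
        and x' = "\<lambda>i t. - a i t * x i (h i t) + (\<Sum>j\<in>UNIV. f i j t)" and ?T0.0 = "t0 - \<sigma>"])
    show "(b has_real_derivative (B + 1) * b u) (at u)" for u
      unfolding b_def by (auto intro!: derivative_eq_intros simp: algebra_simps)
    show "\<bar>x j u\<bar> < b u" if "t0 - \<sigma> \<le> u" "u \<le> t0" for j u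
    proof -
      have "K \<le> b u"
        using that \<open>K > 0\<close> \<open>B \<ge> 0\<close> by (simp add: b_def)
      then show ?thesis
        using init[OF that, of j] by simp
    qed
    show "\<exists>c < (B + 1) * b u. \<forall>\<^sub>F v in at_left u. v \<notin> E \<longrightarrow> s * (- a j v * x j (h j v) + (\<Sum>k\<in>UNIV. f j k v)) \<le> c"
      if "t0 < u" "s \<in> {1, -1}" and le: "\<And>k v. \<lbrakk>t0 - \<sigma> \<le> v; v \<le> u\<rbrakk> \<Longrightarrow> \<bar>x k v\<bar> \<le> b v" for j u s
    proof (intro exI conjI)
      show "B * b u < (B + 1) * b u"
        using \<open>K > 0\<close> by (simp add: b_def)
      have "s * (- a j v * x j (h j v) + (\<Sum>k\<in>UNIV. f j k v)) \<le> B * b u" if v: "v \<in> {t0<..<u}" for v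
      proof -
        have "\<bar>x k r\<bar> \<le> b u" if "v - \<sigma> \<le> r" "r \<le> v" for k r
          using le[of r k] mono[of r u] v that by auto
        then have "\<bar>- a j v * x j (h j v) + (\<Sum>k\<in>UNIV. f j k v)\<bar> \<le> A j * b u + (\<Sum>k\<in>UNIV. L j k * b u)"
          using v by (intro derivative_le) auto
        also have "\<dots> = (A j + (\<Sum>k\<in>UNIV. L j k)) * b u"
          by (simp add: algebra_simps sum_distrib_left)
        also have "\<dots> \<le> B * b u"
          using \<open>K > 0\<close> by (intro mult_right_mono B) (simp add: b_def)
        finally show ?thesis
          using \<open>s \<in> {1, -1}\<close> by auto
      qed
      then show "\<forall>\<^sub>F v in at_left u. v \<notin> E \<longrightarrow> s * (- a j v * x j (h j v) + (\<Sum>k\<in>UNIV. f j k v)) \<le> B * b u"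
        using eventually_at_left_real[OF \<open>t0 < u\<close>] by (auto elim!: eventually_mono)
    qed
  qed (use ac E der \<sigma> \<open>t0 - \<sigma> \<le> t\<close> in auto)
  then show ?thesis
    by (simp add: b_def)
qed

text \<open>The delayed value \<open>x\<^sub>i(h\<^sub>i(t))\<close> differs from \<open>x\<^sub>i(t)\<close> by at most \<open>\<tau>\<^sub>i\<close> times a bound on the
  derivative. That bound looks back a further \<open>\<sigma>\<close>, hence the window of length \<open>2\<sigma>\<close>. The condition
  \<open>t0 + \<sigma> < t\<close> ensures that the equation holds between \<open>h\<^sub>i(t)\<close> and \<open>t\<close>.\<close>

lemma damped_derivative_le:
  assumes t: "t0 + \<sigma> < t" and s: "s \<in> {1, -1}" and pos: "0 \<le> s * x i t"
    and R: "\<And>j u. \<lbrakk>t - 2 * \<sigma> \<le> u; u \<le> t\<rbrakk> \<Longrightarrow> \<bar>x j u\<bar> \<le> R j"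
  shows "s * (- a i t * x i (h i t) + (\<Sum>j\<in>UNIV. f i j t))
      \<le> - \<alpha> i * (s * x i t) + (A i * \<tau> i * (A i * R i + (\<Sum>j\<in>UNIV. L i j * R j)) + (\<Sum>j\<in>UNIV. L i j * R j))"
proof -
  define C where "C = A i * R i + (\<Sum>j\<in>UNIV. L i j * R j)"
  have "t0 < t"
    using t \<sigma> by linarith
  note ht = h[OF \<open>t0 < t\<close>, of i] and at = a[OF \<open>t0 < t\<close>, of i]
  have "t0 < h i t" "t - \<sigma> \<le> h i t"
    using t ht \<tau>[of i] by linarith+
  have "0 \<le> R j" for j
    using R[of t j] \<sigma> by force
  then have "0 \<le> C"
    unfolding C_def using A_nonneg L by (intro add_nonneg_nonneg sum_nonneg mult_nonneg_nonneg) auto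
  have "\<bar>x i t - x i (h i t)\<bar> \<le> C * (t - h i t)"
  proof (rule abs_cont_on_increment_abs_le[OF _ _ E])
    show "abs_cont_on {h i t..t} (x i)"
      using ac[of i] \<open>t0 < h i t\<close> unfolding locally_abs_cont_on_def by auto
    show "(x i has_real_derivative - a i u * x i (h i u) + (\<Sum>j\<in>UNIV. f i j u)) (at u)"
      if "u \<in> {h i t<..<t} - E" for u
      using that \<open>t0 < h i t\<close> by (intro der) auto
    show "\<bar>- a i u * x i (h i u) + (\<Sum>j\<in>UNIV. f i j u)\<bar> \<le> C" if "u \<in> {h i t<..<t} - E" for u
      unfolding C_def using that \<open>t0 < h i t\<close> \<open>t - \<sigma> \<le> h i t\<close> by (intro derivative_le R) auto
  qed (use ht in auto)
  also have "\<dots> \<le> C * \<tau> i"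
    using ht \<open>0 \<le> C\<close> by (intro mult_left_mono) auto
  finally have lag: "\<bar>x i t - x i (h i t)\<bar> \<le> C * \<tau> i" .
  have "s * (- a i t * x i (h i t)) = - (a i t * (s * x i t)) + a i t * (s * (x i t - x i (h i t)))"
    by (simp add: algebra_simps)
  also have "\<dots> \<le> - (\<alpha> i * (s * x i t)) + A i * (C * \<tau> i)"
  proof (intro add_mono)
    show "- (a i t * (s * x i t)) \<le> - (\<alpha> i * (s * x i t))"
      using at pos by (intro le_imp_neg_le mult_right_mono) auto
    have "a i t * (s * (x i t - x i (h i t))) \<le> a i t * (C * \<tau> i)"
      using at \<alpha>[of i] s lag by (intro mult_left_mono) auto
    also have "\<dots> \<le> A i * (C * \<tau> i)"
      using at lag by (intro mult_right_mono) auto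
    finally show "a i t * (s * (x i t - x i (h i t))) \<le> A i * (C * \<tau> i)" .
  qed
  finally have "s * (- a i t * x i (h i t)) \<le> - (\<alpha> i * (s * x i t)) + A i * (C * \<tau> i)" .
  moreover have "s * (\<Sum>j\<in>UNIV. f i j t) \<le> (\<Sum>j\<in>UNIV. L i j * R j)"
  proof -
    have "\<bar>\<Sum>j\<in>UNIV. f i j t\<bar> \<le> (\<Sum>j\<in>UNIV. L i j * R j)"
      using \<sigma> by (intro coupling_le[OF \<open>t0 < t\<close>] R) auto
    then show ?thesis
      using s by auto
  qed
  ultimately show ?thesis
    unfolding C_def[symmetric] by (simp add: algebra_simps)
qed

text \<open>The factor \<open>exp (2 * \<gamma> * \<sigma>)\<close> in the rate condition is the ratio by which the barriers
  fall within the window of \<open>damped_derivative_le\<close>.\<close>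

lemma decay_bound:
  assumes w: "\<And>i. 0 < w i" and "0 < P" and "0 < \<gamma>"
    and rate: "\<And>i. exp (2 * \<gamma> * \<sigma>) * (A i * \<tau> i * (A i * w i + (\<Sum>j\<in>UNIV. L i j * w j)) + (\<Sum>j\<in>UNIV. L i j * w j))
        + \<gamma> * w i < \<alpha> i * w i"
    and init: "\<And>i t. \<lbrakk>t0 - \<sigma> \<le> t; t \<le> t0 + \<sigma>\<rbrakk> \<Longrightarrow> \<bar>x i t\<bar> < P * w i * exp (- \<gamma> * (t - t0))"
    and "t0 - \<sigma> \<le> t"
  shows "\<bar>x i t\<bar> < P * w i * exp (- \<gamma> * (t - t0))"
proof (rule strictly_below_barrier[where T = "t0 + \<sigma>" and E = E and b = "\<lambda>i t. P * w i * exp (- \<gamma> * (t - t0))"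
        and b' = "\<lambda>i t. - \<gamma> * (P * w i * exp (- \<gamma> * (t - t0)))"
        and x' = "\<lambda>i t. - a i t * x i (h i t) + (\<Sum>j\<in>UNIV. f i j t)" and ?T0.0 = "t0 - \<sigma>"])
  show "locally_abs_cont_on {t0 + \<sigma>..} (x j)" for j
    using ac[of j] \<sigma> unfolding locally_abs_cont_on_def by (meson atLeast_subset_iff le_add_same_cancel1 order_trans)
  show "((\<lambda>t. P * w j * exp (- \<gamma> * (t - t0))) has_real_derivative - \<gamma> * (P * w j * exp (- \<gamma> * (u - t0)))) (at u)" for j u
    by (auto intro!: derivative_eq_intros)
  show "(x j has_real_derivative - a j t * x j (h j t) + (\<Sum>k\<in>UNIV. f j k t)) (at t)"
    if "t0 + \<sigma> < t" "t \<notin> E" for j t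
    using that \<sigma> by (intro der) auto
next
  fix j t and s :: real
  assume t: "t0 + \<sigma> < t" and s: "s \<in> {1, -1}" and s_eq: "s * x j t = P * w j * exp (- \<gamma> * (t - t0))"
    and below: "\<And>k u. \<lbrakk>t0 - \<sigma> \<le> u; u \<le> t\<rbrakk> \<Longrightarrow> \<bar>x k u\<bar> \<le> P * w k * exp (- \<gamma> * (u - t0))"
  define q where "q = A j * \<tau> j * (A j * w j + (\<Sum>k\<in>UNIV. L j k * w k)) + (\<Sum>k\<in>UNIV. L j k * w k)"
  \<comment> \<open>An upper bound for the slope of \<open>s * x j\<close> just before \<open>t\<close>. It is continuous from the left, so it
      suffices to compare it with the slope of the barrier at \<open>t\<close> itself.\<close>
  define \<Psi> where "\<Psi> u = - \<alpha> j * (s * x j u) + P * exp (- \<gamma> * (u - t0)) * (exp (2 * \<gamma> * \<sigma>) * q)" for u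
  have "continuous_on {t0..t} (x j)"
    using ac[of j] unfolding locally_abs_cont_on_def
    by (intro abs_cont_on_imp_continuous_on) auto
  then have lim: "(x j \<longlongrightarrow> x j t) (at_left t)"
    using t \<sigma> by (intro continuous_on_Icc_at_leftD[of t0]) auto
  have "\<Psi> t = P * exp (- \<gamma> * (t - t0)) * (exp (2 * \<gamma> * \<sigma>) * q - \<alpha> j * w j)"
    unfolding \<Psi>_def s_eq by (simp add: algebra_simps)
  also have "\<dots> < P * exp (- \<gamma> * (t - t0)) * (- \<gamma> * w j)"
    using rate[of j] \<open>0 < P\<close> by (intro mult_strict_left_mono) (auto simp: q_def)
  finally have "\<Psi> t < - \<gamma> * (P * w j * exp (- \<gamma> * (t - t0)))"
    by (simp add: mult_ac)
  then obtain c where c: "\<Psi> t < c" "c < - \<gamma> * (P * w j * exp (- \<gamma> * (t - t0)))"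
    using dense by blast
  have "(\<Psi> \<longlongrightarrow> \<Psi> t) (at_left t)"
    unfolding \<Psi>_def by (intro tendsto_intros lim)
  then have "\<forall>\<^sub>F u in at_left t. \<Psi> u < c"
    using c(1) by (rule order_tendstoD)
  moreover have "\<forall>\<^sub>F u in at_left t. 0 < s * x j u"
  proof (rule order_tendstoD(1))
    show "((\<lambda>u. s * x j u) \<longlongrightarrow> s * x j t) (at_left t)"
      by (intro tendsto_intros lim)
    show "0 < s * x j t"
      using w[of j] \<open>0 < P\<close> by (simp add: s_eq)
  qed
  moreover note eventually_at_left_real[OF t]
  ultimately have "\<forall>\<^sub>F u in at_left t. s * (- a j u * x j (h j u) + (\<Sum>k\<in>UNIV. f j k u)) \<le> c"
  proof eventually_elim
    case (elim u)
    \<comment> \<open>\<open>e * w k\<close> is the height of the \<open>k\<close>-th barrier at \<open>u - 2 * \<sigma>\<close>, its largest value in the window.\<close>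
    define e where "e = P * exp (- \<gamma> * (u - t0)) * exp (2 * \<gamma> * \<sigma>)"
    have "\<bar>x k v\<bar> \<le> e * w k" if v: "u - 2 * \<sigma> \<le> v" "v \<le> u" for k v
    proof -
      have "\<bar>x k v\<bar> \<le> P * w k * exp (- \<gamma> * (v - t0))"
        using elim v by (intro below) auto
      also have "\<dots> \<le> P * w k * exp (- \<gamma> * (u - t0) + 2 * \<gamma> * \<sigma>)"
      proof -
        have "\<gamma> * (u - 2 * \<sigma>) \<le> \<gamma> * v"
          using v \<open>0 < \<gamma>\<close> by (intro mult_left_mono) auto
        then show ?thesis
          using \<open>0 < P\<close> w[of k] by (intro mult_left_mono) (auto simp: algebra_simps)
      qed
      finally show ?thesis
        unfolding e_def exp_add by (simp only: mult_ac)
    qed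
    then have "s * (- a j u * x j (h j u) + (\<Sum>k\<in>UNIV. f j k u)) \<le> - \<alpha> j * (s * x j u)
        + (A j * \<tau> j * (A j * (e * w j) + (\<Sum>k\<in>UNIV. L j k * (e * w k))) + (\<Sum>k\<in>UNIV. L j k * (e * w k)))"
      using elim s by (intro damped_derivative_le) auto
    also have "(\<Sum>k\<in>UNIV. L j k * (e * w k)) = e * (\<Sum>k\<in>UNIV. L j k * w k)"
      by (simp add: sum_distrib_left mult_ac)
    also have "- \<alpha> j * (s * x j u) + (A j * \<tau> j * (A j * (e * w j) + e * (\<Sum>k\<in>UNIV. L j k * w k)) + e * (\<Sum>k\<in>UNIV. L j k * w k)) = \<Psi> u"
      by (simp add: \<Psi>_def q_def e_def algebra_simps)
    finally show ?case
      using elim by linarith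
  qed
  then show "\<exists>c < - \<gamma> * (P * w j * exp (- \<gamma> * (t - t0))). \<forall>\<^sub>F u in at_left t.
      u \<notin> E \<longrightarrow> s * (- a j u * x j (h j u) + (\<Sum>k\<in>UNIV. f j k u)) \<le> c"
    using c(2) by (auto elim!: eventually_mono)
qed (use E init \<sigma> \<open>t0 - \<sigma> \<le> t\<close> in auto)

text \<open>Growth up to \<open>t0 + \<sigma>\<close> costs at most \<open>exp (2 * (B + 1) * \<sigma>)\<close>, and \<open>exp (\<gamma> * \<sigma>)\<close> makes up for the
  fall of the decaying barrier in the same time. Dividing by the lower bound \<open>\<omega>\<close> of the weights puts every
  barrier above the solution.\<close>

lemma exponential_bound:
  assumes w: "\<And>i. 0 < \<omega> \<and> \<omega> \<le> w i \<and> w i \<le> W" and "0 < \<gamma>"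
    and rate: "\<And>i. exp (2 * \<gamma> * \<sigma>) * (A i * \<tau> i * (A i * w i + (\<Sum>j\<in>UNIV. L i j * w j)) + (\<Sum>j\<in>UNIV. L i j * w j))
        + \<gamma> * w i < \<alpha> i * w i"
    and B: "\<And>i. A i + (\<Sum>j\<in>UNIV. L i j) \<le> B"
    and init: "\<And>i t. \<lbrakk>t0 - \<sigma> \<le> t; t \<le> t0\<rbrakk> \<Longrightarrow> \<bar>x i t\<bar> \<le> \<rho>" and "t0 \<le> t"
  shows "\<bar>x i t\<bar> \<le> exp ((2 * (B + 1) + \<gamma>) * \<sigma>) / \<omega> * W * exp (- \<gamma> * (t - t0)) * \<rho>"
proof -
  define Q where "Q = exp ((2 * (B + 1) + \<gamma>) * \<sigma>) / \<omega>"
  have "0 < \<omega>" "0 < Q" "0 < W"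
    using w[of i] by (auto simp: Q_def)
  have "0 \<le> \<rho>"
    using init[of t0 i] \<sigma> by force
  have "0 \<le> B"
    using B[of i] A_nonneg[of i] L sum_nonneg[of UNIV "L i"] by force
  \<comment> \<open>Barriers bound strictly, so the initial data are first enlarged to some \<open>K > \<rho>\<close>; this also covers
      \<open>\<rho> = 0\<close>.\<close>
  have above: "\<bar>x i t\<bar> \<le> Q * W * exp (- \<gamma> * (t - t0)) * K" if "\<rho> < K" for K
  proof -
    have "0 < K"
      using that \<open>0 \<le> \<rho>\<close> by linarith
    have start: "\<bar>x j u\<bar> < K * Q * w j * exp (- \<gamma> * (u - t0))" if u: "t0 - \<sigma> \<le> u" "u \<le> t0 + \<sigma>" for j u
    proof -
      have "\<bar>x j u\<bar> < K * exp ((B + 1) * (u - t0 + \<sigma>))"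
        using init \<open>\<rho> < K\<close> u by (intro growth_bound B) (auto intro: le_less_trans)
      also have "\<dots> \<le> K * exp ((2 * (B + 1) + \<gamma>) * \<sigma> - \<gamma> * (u - t0))"
      proof -
        have "(B + 1) * (u - t0 + \<sigma>) \<le> (B + 1) * (2 * \<sigma>)" "\<gamma> * (u - t0) \<le> \<gamma> * \<sigma>"
          using u \<open>0 \<le> B\<close> \<open>0 < \<gamma>\<close> by (intro mult_left_mono; simp)+
        then show ?thesis
          using \<open>0 < K\<close> by (intro mult_left_mono) (auto simp: algebra_simps)
      qed
      also have "\<dots> = K * (Q * \<omega>) * exp (- \<gamma> * (u - t0))"
        using \<open>0 < \<omega>\<close> by (simp add: Q_def exp_diff exp_minus divide_inverse)
      also have "\<dots> \<le> K * (Q * w j) * exp (- \<gamma> * (u - t0))"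
        using w[of j] \<open>0 < K\<close> \<open>0 < Q\<close> by (intro mult_right_mono mult_left_mono) auto
      finally show ?thesis
        by (simp add: mult_ac)
    qed
    have "\<bar>x i t\<bar> < K * Q * w i * exp (- \<gamma> * (t - t0))"
    proof (rule decay_bound[OF _ _ \<open>0 < \<gamma>\<close> rate start])
      show "0 < w j" for j
        using w[of j] by linarith
    qed (use \<open>0 < K\<close> \<open>0 < Q\<close> \<open>t0 \<le> t\<close> \<sigma> in auto)
    also have "\<dots> \<le> K * Q * W * exp (- \<gamma> * (t - t0))"
      using w[of i] \<open>0 < K\<close> \<open>0 < Q\<close> by (intro mult_right_mono mult_left_mono) auto
    finally show ?thesis
      by (simp add: mult_ac)
  qed
  define c where "c = Q * W * exp (- \<gamma> * (t - t0))"
  have "0 < c"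
    using \<open>0 < Q\<close> \<open>0 < W\<close> by (simp add: c_def)
  have "\<bar>x i t\<bar> \<le> c * \<rho>"
  proof (rule field_le_epsilon)
    fix e :: real assume "0 < e"
    then show "\<bar>x i t\<bar> \<le> c * \<rho> + e"
      using above[of "\<rho> + e / c"] \<open>0 < c\<close> unfolding c_def[symmetric] by (simp add: distrib_left)
  qed
  then show ?thesis
    by (simp add: c_def Q_def)
qed

end

lemma delay_solution_of_is_solution:
  assumes X: "is_solution a F h g \<sigma> t0 \<phi> X" and "0 \<le> t0"
    and \<alpha>: "\<And>i. 0 < \<alpha> i" and L: "\<And>i j. 0 \<le> L i j" and \<tau>: "\<And>i. \<tau> i \<le> \<sigma>" and \<sigma>: "0 \<le> \<sigma>"
    and a: "\<And>i t. 0 \<le> t \<Longrightarrow> \<alpha> i \<le> a i t \<and> a i t \<le> A i"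
    and F: "\<And>i j t u. 0 \<le> t \<Longrightarrow> \<bar>F i j t u\<bar> \<le> L i j * \<bar>u\<bar>"
    and h: "\<And>i t. 0 \<le> t \<Longrightarrow> 0 \<le> t - h i t \<and> t - h i t \<le> \<tau> i"
    and g: "\<And>i j t. 0 \<le> t \<Longrightarrow> 0 \<le> t - g i j t \<and> t - g i j t \<le> \<sigma>"
  shows "\<exists>E. delay_solution (\<lambda>i t. X t $ i) a h (\<lambda>i j t. F i j t (X (g i j t) $ j)) g A \<alpha> \<tau> L t0 \<sigma> E"
proof -
  have "AE t in lebesgue. t \<in> {t0<..} \<longrightarrow> (\<forall>i. ((\<lambda>s. X s $ i) has_real_derivative
           - a i t * X (h i t) $ i + (\<Sum>j\<in>UNIV. F i j t (X (g i j t) $ j))) (at t))"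
    using X unfolding is_solution_def by (simp add: AE_restrict_space_iff)
  then obtain E where "E \<in> null_sets lebesgue" and der: "\<And>t i. \<lbrakk>t \<notin> E; t0 < t\<rbrakk> \<Longrightarrow> ((\<lambda>s. X s $ i) has_real_derivative
           - a i t * X (h i t) $ i + (\<Sum>j\<in>UNIV. F i j t (X (g i j t) $ j))) (at t)"
    by (rule AE_E3) auto
  have ac: "locally_abs_cont_on {t0..} (\<lambda>t. X t $ i)" for i
    unfolding locally_abs_cont_on_def
  proof (intro allI impI)
    fix b c assume "{b..c} \<subseteq> {t0..}"
    then have "abs_cont_on {b..c} X"
      using X unfolding is_solution_def locally_abs_cont_on_def by blast
    then show "abs_cont_on {b..c} (\<lambda>t. X t $ i)"
      by (rule abs_cont_on_norm_le) (metis real_norm_def component_le_norm_cart vector_minus_component)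
  qed
  have "negligible E"
    using \<open>E \<in> null_sets lebesgue\<close> by (simp add: negligible_iff_null_sets)
  show ?thesis
    by (intro exI[of _ E] delay_solution.intro)
      (fact ac \<open>negligible E\<close> \<alpha> L \<tau> \<sigma> | (rule der a F h g; use \<open>0 \<le> t0\<close> in simp))+
qed

section \<open>Norms on a finite-dimensional space\<close>

lemma is_norm_le_coordinates:
  fixes N :: "real^'n::finite \<Rightarrow> real"
  assumes N: "is_norm N"
  obtains C where "0 < C" "\<And>x K. (\<And>i. \<bar>x $ i\<bar> \<le> K) \<Longrightarrow> N x \<le> C * K"
proof -
  define C where "C = (\<Sum>i\<in>UNIV. N (axis i 1)) + 1"
  have nonneg: "0 \<le> N y" for y
    using N unfolding is_norm_def by blast
  have "N 0 = 0"
    using N unfolding is_norm_def by blast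
  have triangle: "N (\<Sum>i\<in>I. y i) \<le> (\<Sum>i\<in>I. N (y i))" for I :: "'n set" and y
  proof (induction I rule: infinite_finite_induct)
    case (insert i I)
    have "N (y i + (\<Sum>i\<in>I. y i)) \<le> N (y i) + N (\<Sum>i\<in>I. y i)"
      using N unfolding is_norm_def by blast
    then show ?case
      using insert by simp
  qed (use \<open>N 0 = 0\<close> in auto)
  show thesis
  proof (rule that)
    show "0 < C"
      using nonneg by (simp add: C_def sum_nonneg add_nonneg_pos)
    fix x :: "real^'n" and K
    assume K: "\<And>i. \<bar>x $ i\<bar> \<le> K"
    then have "0 \<le> K"
      using abs_ge_zero order_trans by blast
    have "N x = N (\<Sum>i\<in>UNIV. x $ i *\<^sub>R axis i 1)"
      using basis_expansion[of x] by (simp add: scalar_mult_eq_scaleR)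
    also have "\<dots> \<le> (\<Sum>i\<in>UNIV. N (x $ i *\<^sub>R axis i 1))"
      by (rule triangle)
    also have "\<dots> = (\<Sum>i\<in>UNIV. \<bar>x $ i\<bar> * N (axis i 1))"
      using N unfolding is_norm_def by simp
    also have "\<dots> \<le> (\<Sum>i\<in>UNIV. K * N (axis i 1))"
      by (intro sum_mono mult_right_mono K nonneg)
    also have "\<dots> \<le> C * K"
      using \<open>0 \<le> K\<close> by (simp add: C_def algebra_simps sum_distrib_left)
    finally show "N x \<le> C * K" .
  qed
qed

lemma is_norm_continuous_on:
  fixes N :: "real^'n::finite \<Rightarrow> real"
  assumes N: "is_norm N"
  shows "continuous_on S N"
proof -
  obtain C where "0 < C" and C: "\<And>x K. (\<And>i. \<bar>x $ i\<bar> \<le> K) \<Longrightarrow> N x \<le> C * K"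
    using is_norm_le_coordinates[OF N] by blast
  have le: "N x \<le> N y + C * norm (x - y)" for x y
  proof -
    have "N (y + (x - y)) \<le> N y + N (x - y)"
      using N unfolding is_norm_def by blast
    moreover have "N (x - y) \<le> C * norm (x - y)"
      by (rule C) (rule component_le_norm_cart)
    ultimately show ?thesis
      by simp
  qed
  have "dist (N x) (N y) \<le> C * dist x y" for x y
    using le[of x y] le[of y x] by (simp add: dist_norm norm_minus_commute)
  then have "C-lipschitz_on S N"
    using \<open>0 < C\<close> by (intro lipschitz_onI) auto
  then show ?thesis
    by (rule lipschitz_on_continuous_on)
qed

text \<open>By homogeneity it suffices to bound \<open>N\<close> from below on the unit sphere, where it attains a positive
  minimum by compactness.\<close>

lemma coordinates_le_is_norm:
  fixes N :: "real^'n::finite \<Rightarrow> real"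
  assumes N: "is_norm N"
  obtains m where "0 < m" "\<And>x i. m * \<bar>x $ i\<bar> \<le> N x"
proof -
  have "sphere (0 :: real^'n) 1 \<noteq> {}"
    by simp
  then obtain z where z: "z \<in> sphere 0 1" "\<And>y. y \<in> sphere 0 1 \<Longrightarrow> N z \<le> N y"
    using continuous_attains_inf[OF compact_sphere _ is_norm_continuous_on[OF N]] by metis
  show thesis
  proof (rule that)
    have "z \<noteq> 0"
      using z(1) by auto
    then show "0 < N z"
      using N unfolding is_norm_def by (metis less_eq_real_def)
    fix x :: "real^'n" and i
    have "N z * norm x \<le> N x"
    proof (cases "x = 0")
      case True
      then show ?thesis
        using N by (simp add: is_norm_def)
    next
      case False
      have "N x = norm x * N ((1 / norm x) *\<^sub>R x)"
        using False N unfolding is_norm_def by simp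
      moreover have "N z \<le> N ((1 / norm x) *\<^sub>R x)"
        using False by (intro z) simp
      ultimately show ?thesis
        using mult_left_mono[of "N z" "N ((1 / norm x) *\<^sub>R x)" "norm x"] by (simp add: mult.commute)
    qed
    moreover have "N z * \<bar>x $ i\<bar> \<le> N z * norm x"
      using \<open>0 < N z\<close> component_le_norm_cart[of x i] by (intro mult_left_mono) auto
    ultimately show "N z * \<bar>x $ i\<bar> \<le> N x"
      by linarith
  qed
qed

text \<open>Continuity of the initial function makes its norms bounded above, without which \<open>sup0\<close> would be
  meaningless. The supremum excludes \<open>t0\<close>, where \<open>N (X t0)\<close> takes over; for \<open>\<sigma> = 0\<close> nothing else is left.\<close>

lemma is_norm_initial_bound:
  fixes \<phi> X :: "real \<Rightarrow> real^'n::finite"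
  assumes N: "is_norm N" and \<phi>: "continuous_on {t0 - \<sigma>..t0} \<phi>"
    and X: "\<And>t. t \<in> {t0 - \<sigma>..t0} \<Longrightarrow> X t = \<phi> t" and s: "s \<in> {t0 - \<sigma>..t0}"
  shows "N (X s) \<le> N (X t0) + sup0 ((\<lambda>s. N (\<phi> s)) ` {t0 - \<sigma>..<t0})"
proof -
  let ?S = "(\<lambda>s. N (\<phi> s)) ` {t0 - \<sigma>..<t0}"
  have nonneg: "0 \<le> N y" for y
    using N unfolding is_norm_def by blast
  have "compact ((\<lambda>s. N (\<phi> s)) ` {t0 - \<sigma>..t0})"
    by (intro compact_continuous_image continuous_on_compose2[OF is_norm_continuous_on[OF N] \<phi>, of UNIV]) auto
  then have bdd: "bdd_above ?S"
    by (intro bdd_above_mono[OF bounded_imp_bdd_above[OF compact_imp_bounded]]) auto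
  have upper: "y \<le> sup0 ?S" if "y \<in> ?S" for y
    using that bdd by (auto simp: sup0_def intro: cSup_upper)
  have "0 \<le> sup0 ?S"
  proof (cases "?S = {}")
    case False
    then obtain r where "r \<in> {t0 - \<sigma>..<t0}"
      by blast
    then have "N (\<phi> r) \<le> sup0 ?S"
      by (intro upper imageI)
    then show ?thesis
      using nonneg[of "\<phi> r"] by linarith
  qed (simp add: sup0_def)
  show ?thesis
  proof (cases "s = t0")
    case True
    then show ?thesis
      using \<open>0 \<le> sup0 ?S\<close> by simp
  next
    case False
    then have "N (X s) \<le> sup0 ?S"
      using s by (intro upper) (auto simp: X)
    then show ?thesis
      using nonneg[of "X t0"] by linarith
  qed
qed

section \<open>Weights, decay rate and stability\<close>

text \<open>At \<open>\<gamma> = 0\<close> the inequality is the hypothesis, and both sides are continuous in \<open>\<gamma>\<close>.\<close>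

lemma exists_decay_rate:
  fixes q w \<alpha> :: "'n::finite \<Rightarrow> real"
  assumes "\<And>i. q i < \<alpha> i * w i"
  obtains \<gamma> where "0 < \<gamma>" "\<And>i. exp (2 * \<gamma> * \<sigma>) * q i + \<gamma> * w i < \<alpha> i * w i"
proof -
  have "\<forall>\<^sub>F \<gamma> in at_right 0. exp (2 * \<gamma> * \<sigma>) * q i + \<gamma> * w i < \<alpha> i * w i" for i
  proof (rule order_tendstoD(2))
    show "((\<lambda>\<gamma>. exp (2 * \<gamma> * \<sigma>) * q i + \<gamma> * w i) \<longlongrightarrow> exp (2 * 0 * \<sigma>) * q i + 0 * w i) (at_right 0)"
      by (intro tendsto_intros)
  qed (use assms in auto)
  then have "\<forall>\<^sub>F \<gamma> in at_right 0. \<forall>i. exp (2 * \<gamma> * \<sigma>) * q i + \<gamma> * w i < \<alpha> i * w i"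
    by (rule eventually_all_finite)
  moreover have "\<forall>\<^sub>F \<gamma> in at_right (0::real). 0 < \<gamma>"
    by (rule eventually_at_right_less)
  ultimately have "\<forall>\<^sub>F \<gamma> in at_right 0. 0 < \<gamma> \<and> (\<forall>i. exp (2 * \<gamma> * \<sigma>) * q i + \<gamma> * w i < \<alpha> i * w i)"
    by eventually_elim simp
  then obtain \<gamma> where "0 < \<gamma> \<and> (\<forall>i. exp (2 * \<gamma> * \<sigma>) * q i + \<gamma> * w i < \<alpha> i * w i)"
    using eventually_happens'[OF trivial_limit_at_right_real] by blast
  then show thesis
    using that by blast
qed

text \<open>The weights are the row sums of the adjugate of the matrix with rows \<open>(d1, - c1)\<close> and
  \<open>(- c2, d2)\<close>. The matrix maps them to a vector whose two entries both equal the determinant, which is positive.\<close>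

lemma positive_weights:
  fixes d1 d2 c1 c2 :: real
  assumes "0 < d1" "0 \<le> c1" "0 \<le> c2" "c1 * c2 < d1 * d2"
  shows "0 < c1 + d2" "0 < c2 + d1" "c1 * (c2 + d1) < d1 * (c1 + d2)" "c2 * (c1 + d2) < d2 * (c2 + d1)"
proof -
  have "0 \<le> c1 * c2"
    using assms by simp
  then have "0 < d1 * d2"
    using assms(4) by linarith
  then have "0 < d2"
    using \<open>0 < d1\<close> by (simp add: zero_less_mult_iff)
  then show "0 < c1 + d2" "0 < c2 + d1" "c1 * (c2 + d1) < d1 * (c1 + d2)" "c2 * (c1 + d2) < d2 * (c2 + d1)"
    using assms by (auto simp: algebra_simps)
qed

theorem corollary5:
  fixes A \<alpha> \<tau> :: "2 \<Rightarrow> real" and \<sigma> L :: "2 \<Rightarrow> 2 \<Rightarrow> real" and \<sigma>max :: real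
    and a h :: "2 \<Rightarrow> real \<Rightarrow> real" and g :: "2 \<Rightarrow> 2 \<Rightarrow> real \<Rightarrow> real"
    and F :: "2 \<Rightarrow> 2 \<Rightarrow> real \<Rightarrow> real \<Rightarrow> real" and N :: "real^2 \<Rightarrow> real"
  assumes norm: "is_norm N"
    and constants: "\<And>i. A i \<ge> \<alpha> i" "\<And>i. \<alpha> i > 0" "\<And>i. \<tau> i \<ge> 0"
      "\<And>i j. \<sigma> i j \<ge> 0" "\<And>i j. L i j \<ge> 0"
    and a_meas: "\<And>i. a i \<in> borel_measurable (lebesgue_on {0..})"
    and a_ess_bounded: "\<And>i. \<exists>B. AE t in lebesgue_on {0..}. \<bar>a i t\<bar> \<le> B"
    and a_bounds: "\<And>i t. t \<ge> 0 \<Longrightarrow> \<alpha> i \<le> a i t \<and> a i t \<le> A i"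
    and F_cont: "\<And>i j t. t \<ge> 0 \<Longrightarrow> continuous_on UNIV (F i j t)"
    and F_meas: "\<And>i j u. (\<lambda>t. F i j t u) \<in> borel_measurable (lebesgue_on {0..})"
    and F_loc_ess_bounded: "\<And>i j u T. \<exists>B. AE t in lebesgue_on {0..T}. \<bar>F i j t u\<bar> \<le> B"
    and F_growth: "\<And>i j t u. t \<ge> 0 \<Longrightarrow> \<bar>F i j t u\<bar> \<le> L i j * \<bar>u\<bar>"
    and h_meas: "\<And>i. h i \<in> borel_measurable (lebesgue_on {0..})"
    and h_delay: "\<And>i t. t \<ge> 0 \<Longrightarrow> 0 \<le> t - h i t \<and> t - h i t \<le> \<tau> i"
    and g_meas: "\<And>i j. g i j \<in> borel_measurable (lebesgue_on {0..})"
    and g_delay: "\<And>i j t. t \<ge> 0 \<Longrightarrow> 0 \<le> t - g i j t \<and> t - g i j t \<le> \<sigma> i j"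
    and \<sigma>max: "\<sigma>max = Max (range \<tau> \<union> (\<Union>i. range (\<sigma> i)))"
    and solvable: "unique_solvability a F h g \<sigma>max"
    and cond1: "A 1 * (A 1 + L 1 1) * \<tau> 1 + L 1 1 < \<alpha> 1"
    and cond2: "(\<alpha> 1 - A 1 * (A 1 + L 1 1) * \<tau> 1 - L 1 1) *
                (\<alpha> 2 - A 2 * (A 2 + L 2 2) * \<tau> 2 - L 2 2)
                > L 1 2 * L 2 1 * (1 + A 1 * \<tau> 1) * (1 + A 2 * \<tau> 2)"
  shows "globally_exponentially_stable N a F h g \<sigma>max"
proof -
  have "finite (range \<tau> \<union> (\<Union>i. range (\<sigma> i)))"
    by simp
  then have \<tau>_le: "\<tau> i \<le> \<sigma>max" and \<sigma>_le: "\<sigma> i j \<le> \<sigma>max" for i j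
    unfolding \<sigma>max by (intro Max_ge; blast)+
  have "0 \<le> \<sigma>max"
    using constants(3)[of 1] \<tau>_le[of 1] by linarith
  have "0 \<le> A i" for i
    using constants(1,2)[of i] by linarith

  define d where "d i = \<alpha> i - A i * (A i + L i i) * \<tau> i - L i i" for i
  \<comment> \<open>In these terms the right-hand sides of the damped inequalities, at \<open>x\<^sub>i = R\<^sub>i\<close> and \<open>R = w\<close>, are
      \<open>c1 * w 2 - d 1 * w 1\<close> and \<open>c2 * w 1 - d 2 * w 2\<close>.\<close>
  define c1 where "c1 = L 1 2 * (1 + A 1 * \<tau> 1)"
  define c2 where "c2 = L 2 1 * (1 + A 2 * \<tau> 2)"
  have "0 < d 1" "0 \<le> c1" "0 \<le> c2" "c1 * c2 < d 1 * d 2"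
    using cond1 cond2 constants \<open>\<And>i. 0 \<le> A i\<close> by (auto simp: d_def c1_def c2_def mult_ac)
  note weights = positive_weights[OF this]
  define w :: "2 \<Rightarrow> real" where "w i = (if i = 1 then c1 + d 2 else c2 + d 1)" for i
  define q where "q i = A i * \<tau> i * (A i * w i + (\<Sum>j\<in>UNIV. L i j * w j)) + (\<Sum>j\<in>UNIV. L i j * w j)" for i
  have "q i < \<alpha> i * w i" for i
  proof -
    have "q 1 = (\<alpha> 1 - d 1) * w 1 + c1 * w 2" "q 2 = (\<alpha> 2 - d 2) * w 2 + c2 * w 1"
      by (simp_all add: q_def sum_2 d_def c1_def c2_def algebra_simps)
    then have "q 1 < \<alpha> 1 * w 1" "q 2 < \<alpha> 2 * w 2"
      using weights by (simp_all add: w_def algebra_simps)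
    then show ?thesis
      using exhaust_2[of i] by auto
  qed
  then obtain \<gamma> where "0 < \<gamma>" and \<gamma>: "\<And>i. exp (2 * \<gamma> * \<sigma>max) * q i + \<gamma> * w i < \<alpha> i * w i"
    using exists_decay_rate[of q \<alpha> w] by metis

  define \<omega> where "\<omega> = min (w 1) (w 2)"
  define W where "W = max (w 1) (w 2)"
  have w: "0 < \<omega> \<and> \<omega> \<le> w i \<and> w i \<le> W" for i
    using weights exhaust_2[of i] by (auto simp: \<omega>_def W_def w_def)
  define B where "B = (\<Sum>i\<in>UNIV. A i + (\<Sum>j\<in>UNIV. L i j))"
  have B: "A i + (\<Sum>j\<in>UNIV. L i j) \<le> B" for i
    unfolding B_def using constants(5) \<open>\<And>i. 0 \<le> A i\<close>
    by (intro member_le_sum add_nonneg_nonneg sum_nonneg) auto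
  define Q where "Q = exp ((2 * (B + 1) + \<gamma>) * \<sigma>max) / \<omega> * W"
  have "0 < Q"
    using w[of 1] by (auto simp: Q_def)

  obtain C where "0 < C" and C: "\<And>x K. (\<And>i. \<bar>x $ i\<bar> \<le> K) \<Longrightarrow> N x \<le> C * K"
    using is_norm_le_coordinates[OF norm] by blast
  obtain m where "0 < m" and m: "\<And>x i. m * \<bar>x $ i\<bar> \<le> N x"
    using coordinates_le_is_norm[OF norm] by blast
  show ?thesis
    unfolding globally_exponentially_stable_def
  proof (intro exI conjI allI impI)
    show "0 < C * Q / m" "0 < \<gamma>"
      using \<open>0 < C\<close> \<open>0 < Q\<close> \<open>0 < m\<close> \<open>0 < \<gamma>\<close> by simp_all
    fix t0 \<phi> X t
    assume "0 \<le> t0" and \<phi>: "continuous_on {t0 - \<sigma>max..t0} \<phi>"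
      and X: "is_solution a F h g \<sigma>max t0 \<phi> X" and "t0 \<le> t"
    define \<rho> where "\<rho> = N (X t0) + sup0 ((\<lambda>s. N (\<phi> s)) ` {t0 - \<sigma>max..<t0})"
    have "0 \<le> t - g i j t \<and> t - g i j t \<le> \<sigma>max" if "0 \<le> t" for i j t
      using g_delay[OF that, of i j] \<sigma>_le[of i j] by linarith
    then obtain E where "delay_solution (\<lambda>i t. X t $ i) a h (\<lambda>i j t. F i j t (X (g i j t) $ j)) g A \<alpha> \<tau> L t0 \<sigma>max E"
      using delay_solution_of_is_solution[OF X \<open>0 \<le> t0\<close> constants(2,5) \<tau>_le \<open>0 \<le> \<sigma>max\<close> a_bounds F_growth h_delay]
      by blast
    then interpret delay_solution "\<lambda>i t. X t $ i" a h "\<lambda>i j t. F i j t (X (g i j t) $ j)" g A \<alpha> \<tau> L t0 \<sigma>max E .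
    have "\<bar>X s $ i\<bar> \<le> \<rho> / m" if "t0 - \<sigma>max \<le> s" "s \<le> t0" for s i
    proof -
      have "N (X s) \<le> \<rho>"
        unfolding \<rho>_def using X that by (intro is_norm_initial_bound[OF norm \<phi>]) (auto simp: is_solution_def)
      then show ?thesis
        using m[of "X s" i] \<open>0 < m\<close> by (simp add: le_divide_eq mult.commute)
    qed
    then have "\<bar>X t $ i\<bar> \<le> Q * exp (- \<gamma> * (t - t0)) * (\<rho> / m)" for i
      unfolding Q_def using \<open>t0 \<le> t\<close> by (intro exponential_bound[OF w \<open>0 < \<gamma>\<close> \<gamma>[unfolded q_def] B]) auto
    then have "N (X t) \<le> C * (Q * exp (- \<gamma> * (t - t0)) * (\<rho> / m))"
      by (rule C)
    then show "N (X t) \<le> C * Q / m * exp (- \<gamma> * (t - t0)) *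
        (N (X t0) + sup0 ((\<lambda>s. N (\<phi> s)) ` {t0 - \<sigma>max..<t0}))"
      by (simp add: \<rho>_def)
  qed
qed

end
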